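(* Let $h \geq 1$ and $\ell \geq 14$ be integers, and let $H$ be a graph on $n$ vertices of maximum degree at most $h$ such that at most $\frac{1}{60}\cdot n$ vertices of $H$ have degree less than $\ell$. Then there are at most $h^2 \cdot 2^n \cdot e^{-\frac{n}{1800h^4}}$ subsets $S$ of $V(H)$ such that $|L(S)| \geq \frac{1}{20}\cdot n$.
   Context: All graphs are finite and simple. For $S \subseteq V(H)$ and a vertex $v$, $d_S(v)$ denotes the number of vertices of $S$ adjacent to $v$ in $H$. The set $L(S) = \{v \in V(H) : d_S(v) \leq 2\}$ is the set of vertices of low $S$-degree. *)

theory Defs
  imports Complex_Main "Graph_Theory.Pair_Digraph"
begin

text \<open>
  A finite simple graph is a \<^locale>\<open>pair_graph\<close>: a finite, loop-free, symmetric digraph whose arcs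
  are pairs of vertices. An undirected edge \<open>uv\<close> is represented by the two arcs \<open>(u, v)\<close>, \<open>(v, u)\<close>,
  so the degree of a vertex is its \<^const>\<open>out_degree\<close>.
\<close>

definition deg_in :: "'a pair_pre_digraph \<Rightarrow> 'a set \<Rightarrow> 'a \<Rightarrow> nat" where
  "deg_in H S v = card {u \<in> S. (v, u) \<in> parcs H}"

definition low_deg :: "'a pair_pre_digraph \<Rightarrow> 'a set \<Rightarrow> 'a set" where
  "low_deg H S = {v \<in> pverts H. deg_in H S v \<le> 2}"

lemma (in pair_graph) out_degree_eq_deg_in:
  "out_degree (with_proj G) v = deg_in G (pverts G) v"
proof -
  have "out_arcs (with_proj G) v = Pair v ` {u \<in> pverts G. (v, u) \<in> parcs G}"
    using arc_snd_in_verts by (force simp: out_arcs_def)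
  then show ?thesis
    by (simp add: out_degree_def deg_in_def card_image inj_on_def)
qed

end

theory Submission
  imports Defs
begin

text \<open>
  Colour the vertices of degree at least \<open>l\<close> with \<open>h\<^sup>2\<close> colours so that vertices of equal colour have
  disjoint neighbourhoods. For a uniformly random \<open>S\<close> the events \<open>d\<^sub>S(v) \<le> 2\<close>, for \<open>v\<close> in a colour
  class \<open>C\<close>, are then independent, each of probability at most \<open>1/120\<close>, so the number \<open>X\<close> of them that
  occur satisfies \<open>E (exp X) \<le> exp (|C|/60)\<close>, and Markov's inequality gives
  \<open>P (X \<ge> |C|/60 + t) \<le> exp (-t)\<close>. If \<open>|L(S)| \<ge> n/20\<close>, then at least \<open>n/30\<close> vertices of \<open>L(S)\<close> have
  degree at least \<open>l\<close>, so some colour class has \<open>X \<ge> |C|/60 + n/(60 h\<^sup>2)\<close>. A union bound over the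
  colours finishes the proof.
\<close>

text \<open>Greedy colouring: when \<open>v\<close> is added, its \<open>R\<close>-neighbours among
  the coloured vertices use fewer than \<open>k\<close> colours, so one is free for
  \<open>v\<close>.\<close>

lemma ex_proper_colouring:
  assumes "finite V" "\<And>x y. R x y \<Longrightarrow> R y x" "\<And>x. x \<in> V \<Longrightarrow> card {y \<in> V. R x y} < k"
  shows "\<exists>c. c ` V \<subseteq> {..<k::nat} \<and> (\<forall>x\<in>V. \<forall>y\<in>V. x \<noteq> y \<and> R x y \<longrightarrow> c x \<noteq> c y)"
  using assms(1,3)
proof (induction V rule: finite_induct)
  case empty
  then show ?case by simp
next
  case (insert v V)
  have "card {y \<in> V. R x y} < k" if "x \<in> V" for x
    using insert.prems[of x] that insert.hyps
      card_mono[of "{y \<in> insert v V. R x y}" "{y \<in> V. R x y}"] by fastforce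
  then obtain c where c: "c ` V \<subseteq> {..<k}" "\<forall>x\<in>V. \<forall>y\<in>V. x \<noteq> y \<and> R x y \<longrightarrow> c x \<noteq> c y"
    using insert.IH by blast
  have "card (c ` {y \<in> V. R v y}) \<le> card {y \<in> V. R v y}"
    using insert.hyps by (intro card_image_le) auto
  also have "\<dots> \<le> card {y \<in> insert v V. R v y}"
    using insert.hyps by (intro card_mono) auto
  also have "\<dots> < card {..<k}"
    using insert.prems by simp
  finally have "\<not> {..<k} \<subseteq> c ` {y \<in> V. R v y}"
    using insert.hyps card_mono[of "c ` {y \<in> V. R v y}" "{..<k}"] by fastforce
  then obtain i where i: "i < k" "i \<notin> c ` {y \<in> V. R v y}"
    by blast
  have "i \<noteq> c x" if "x \<in> V" "R v x \<or> R x v" for x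
    using i(2) that assms(2)[of x v] by blast
  then show ?case
    using c i(1) insert.hyps by (intro exI[of _ "c(v := i)"]) auto
qed

text \<open>Subsets of \<open>A \<union> B\<close> correspond to pairs of their traces on
  \<open>A\<close> and \<open>B\<close>. This is independence of functions of the two traces, in
  counting form.\<close>

lemma sum_Pow_Un_disjoint:
  fixes f g :: "'a set \<Rightarrow> 'b::comm_semiring_0"
  assumes "A \<inter> B = {}"
  shows "(\<Sum>S\<in>Pow (A \<union> B). f (S \<inter> A) * g (S \<inter> B)) = (\<Sum>S\<in>Pow A. f S) * (\<Sum>S\<in>Pow B. g S)"
proof -
  have "(\<Sum>S\<in>Pow A. f S) * (\<Sum>S\<in>Pow B. g S) = (\<Sum>(S, T)\<in>Pow A \<times> Pow B. f S * g T)"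
    by (simp add: sum_product sum.cartesian_product)
  also have "\<dots> = (\<Sum>S\<in>Pow (A \<union> B). f (S \<inter> A) * g (S \<inter> B))"
    using assms
    by (intro sum.reindex_bij_witness[of _ "\<lambda>S. (S \<inter> A, S \<inter> B)" "\<lambda>(S, T). S \<union> T"])
      (auto intro!: arg_cong2[of _ _ _ _ "(*)"] arg_cong[of _ _ f] arg_cong[of _ _ g])
  finally show ?thesis ..
qed

text \<open>Unnormalised product rule for expectations of independent variables:
  \<open>2 ^ card V\<close> counts the sets \<open>S\<close>, and \<open>q\<close> bounds the mean
  of each factor. The induction splits \<open>N v\<close> off from \<open>V\<close>; by disjointness
  the other \<open>N u\<close> lie in the rest, hence \<open>V\<close> is arbitrary.\<close>

lemma sum_Pow_prod_disjoint_le: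
  fixes f :: "'v \<Rightarrow> 'a set \<Rightarrow> real"
  assumes "finite C" "finite V" "\<And>v. v \<in> C \<Longrightarrow> N v \<subseteq> V" "disjoint_family_on N C"
    and "\<And>v S. v \<in> C \<Longrightarrow> 0 \<le> f v S"
    and "\<And>v. v \<in> C \<Longrightarrow> (\<Sum>S\<in>Pow (N v). f v S) \<le> 2 ^ card (N v) * q" "0 \<le> q"
  shows "(\<Sum>S\<in>Pow V. \<Prod>v\<in>C. f v (S \<inter> N v)) \<le> 2 ^ card V * q ^ card C"
  using assms(1-6)
proof (induction C arbitrary: V rule: finite_induct)
  case empty
  then show ?case by (simp add: card_Pow)
next
  case (insert v C)
  define W where "W = V - N v"
  have V: "V = N v \<union> W" "N v \<inter> W = {}" "finite W" "finite (N v)"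
    using insert.prems(1) insert.prems(2)[of v] by (auto simp: W_def finite_subset)
  have NW: "N u \<subseteq> W" if "u \<in> C" for u
  proof -
    have "N u \<inter> N v = {}" "N u \<subseteq> V"
      using disjoint_family_onD[OF insert.prems(3), of u v] insert.prems(2)[of u] insert.hyps that
      by auto
    then show ?thesis
      by (auto simp: W_def)
  qed
  have "(\<Sum>S\<in>Pow V. \<Prod>u\<in>insert v C. f u (S \<inter> N u))
      = (\<Sum>S\<in>Pow (N v \<union> W). f v (S \<inter> N v) * (\<Prod>u\<in>C. f u ((S \<inter> W) \<inter> N u)))"
    using V NW insert.hyps
    by (auto intro!: sum.cong prod.cong arg_cong2[of _ _ _ _ "(*)"] arg_cong2[of _ _ _ _ f])
  also have "\<dots> = (\<Sum>S\<in>Pow (N v). f v S) * (\<Sum>S\<in>Pow W. \<Prod>u\<in>C. f u (S \<inter> N u))"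
    using V(2) by (rule sum_Pow_Un_disjoint)
  also have "\<dots> \<le> (2 ^ card (N v) * q) * (2 ^ card W * q ^ card C)"
  proof (rule mult_mono)
    show "(\<Sum>S\<in>Pow W. \<Prod>u\<in>C. f u (S \<inter> N u)) \<le> 2 ^ card W * q ^ card C"
      using insert.prems NW V
      by (intro insert.IH) (auto simp: disjoint_family_on_def)
  qed (use insert.prems \<open>0 \<le> q\<close> in \<open>auto intro!: sum_nonneg prod_nonneg\<close>)
  also have "\<dots> = 2 ^ card V * q ^ card (insert v C)"
    using V insert.hyps by (simp add: card_Un_disjoint power_add)
  finally show ?case .
qed

lemma card_subsets_le2:
  assumes "finite A"
  shows "card {S. S \<subseteq> A \<and> card S \<le> 2} = 1 + card A + (card A choose 2)"
proof -
  have "{S. S \<subseteq> A \<and> card S \<le> 2} = (\<Union>i\<in>{..2}. {S. S \<subseteq> A \<and> card S = i})"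
    by auto
  also have "card \<dots> = (\<Sum>i\<in>{..2}. card {S. S \<subseteq> A \<and> card S = i})"
    using assms by (intro card_UN_disjoint) auto
  also have "\<dots> = (\<Sum>i\<in>{..2}. card A choose i)"
    using assms by (simp add: n_subsets)
  also have "\<dots> = 1 + card A + (card A choose 2)"
    by (simp add: numeral_2_eq_2)
  finally show ?thesis .
qed

text \<open>This is where 14 comes from: 120 * 106 = 12720 is at most 2^14 = 16384, while the
  inequality fails at 13.\<close>

lemma choose_le2_bound:
  assumes "14 \<le> d"
  shows "120 * (1 + d + (d choose 2)) \<le> 2 ^ d"
  using assms
proof (induction d rule: dec_induct)
  case base
  then show ?case by (simp add: choose_two)
next
  case (step d)
  have "d \<le> d choose 2"
    using step.hyps mult_le_mono2[of 2 "d - 1" d] div_le_mono[of "d * 2" "d * (d - 1)" 2]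
    by (simp add: choose_two)
  \<comment> \<open>By Pascal's rule the left side equals \<open>2 + 2 * d + (d choose 2)\<close>,
    so it at most doubles, as does the power of 2.\<close>
  then have "1 + Suc d + (Suc d choose 2) \<le> 2 * (1 + d + (d choose 2))"
    by (simp add: numeral_2_eq_2)
  then show ?case
    using step.IH by simp
qed

text \<open>If p is the probability that \<open>card S \<le> 2\<close>, the mean of the exponential
  is 1 + (e - 1) p. With e <= 3 and p <= 1/120 this is at most 1 + 1/60.\<close>

lemma sum_exp_low_le:
  assumes "finite A" "14 \<le> card A"
  shows "(\<Sum>S\<in>Pow A. exp (of_bool (card S \<le> 2))) \<le> 2 ^ card A * exp (1 / 60 :: real)"
proof -
  let ?b = "card {S. S \<subseteq> A \<and> card S \<le> 2}"
  have "(\<Sum>S\<in>Pow A. exp (of_bool (card S \<le> 2)))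
      \<le> (\<Sum>S\<in>Pow A. 1 + 2 * (of_bool (card S \<le> 2) :: real))"
    using exp_le by (intro sum_mono) (simp add: of_bool_def)
  also have "\<dots> = 2 ^ card A + 2 * (\<Sum>S\<in>Pow A. of_bool (card S \<le> 2))"
    using assms by (simp add: sum.distrib sum_distrib_left card_Pow)
  also have "(\<Sum>S\<in>Pow A. of_bool (card S \<le> 2)) = real ?b"
    using assms by (simp add: Collect_conj_eq Pow_def)
  also have "2 ^ card A + 2 * real ?b \<le> 2 ^ card A * (1 + 1 / 60)"
  proof -
    have "real (120 * ?b) \<le> real (2 ^ card A)"
      using choose_le2_bound[OF assms(2)] card_subsets_le2[OF assms(1)]
      by (metis of_nat_le_iff)
    then show ?thesis by simp
  qed
  also have "\<dots> \<le> 2 ^ card A * exp (1 / 60)"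
    by (intro mult_left_mono exp_ge_add_one_self) auto
  finally show ?thesis .
qed

lemma card_subsets_many_low_le:
  assumes "finite V" "C \<subseteq> V" "disjoint_family_on N C"
    and "\<And>v. v \<in> C \<Longrightarrow> N v \<subseteq> V" "\<And>v. v \<in> C \<Longrightarrow> 14 \<le> card (N v)"
  shows "real (card {S. S \<subseteq> V \<and> real (card {v \<in> C. card (S \<inter> N v) \<le> 2}) \<ge> card C / 60 + t})
    \<le> 2 ^ card V * exp (- t)"
proof -
  let ?X = "\<lambda>S. real (card {v \<in> C. card (S \<inter> N v) \<le> 2})"
  let ?F = "{S. S \<subseteq> V \<and> ?X S \<ge> card C / 60 + t}"
  have C: "finite C"
    using assms finite_subset by blast
  \<comment> \<open>The count is a sum of indicators, so its exponential is a product whose factors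
    depend on the disjoint traces \<open>S \<inter> N v\<close>.\<close>
  have X: "exp (?X S) = (\<Prod>v\<in>C. exp (of_bool (card (S \<inter> N v) \<le> 2)))" for S
    using C by (simp add: exp_sum[symmetric] Collect_conj_eq)
  \<comment> \<open>Markov's inequality for \<open>exp (?X S)\<close>; the positive factor on the
    left is cancelled at the end.\<close>
  have "real (card ?F) * exp (card C / 60 + t) = (\<Sum>S\<in>?F. exp (card C / 60 + t))"
    by simp
  also have "\<dots> \<le> (\<Sum>S\<in>?F. exp (?X S))"
    by (intro sum_mono) simp
  also have "\<dots> \<le> (\<Sum>S\<in>Pow V. exp (?X S))"
    using assms by (intro sum_mono2) auto
  also have "\<dots> \<le> 2 ^ card V * exp (1 / 60) ^ card C"
    unfolding X using assms C
    by (intro sum_Pow_prod_disjoint_le[where f = "\<lambda>_ S. exp (of_bool (card S \<le> 2))"] sum_exp_low_le)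
      (auto intro: finite_subset)
  also have "\<dots> = 2 ^ card V * exp (- t) * exp (card C / 60 + t)"
    by (simp add: exp_of_nat_mult[symmetric] exp_add[symmetric])
  finally show ?thesis
    by simp
qed

lemma (in pair_graph) ex_square_colouring:
  assumes "1 \<le> h" "\<forall>v\<in>pverts G. card {u. (v, u) \<in> parcs G} \<le> h"
  shows "\<exists>c. c ` pverts G \<subseteq> {..<h\<^sup>2} \<and>
    (\<forall>i. disjoint_family_on (\<lambda>v. {u. (v, u) \<in> parcs G}) {v \<in> pverts G. c v = i})"
proof -
  let ?N = "\<lambda>v. {u. (v, u) \<in> parcs G}"
  define R where "R x y \<longleftrightarrow> x \<noteq> y \<and> ?N x \<inter> ?N y \<noteq> {}" for x y
  have sym: "(x, y) \<in> parcs G \<Longrightarrow> (y, x) \<in> parcs G" for x y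
    using arcs_symmetric by blast
  have N: "?N x \<subseteq> pverts G" for x
    using arc_snd_in_verts by force
  have fin: "finite (?N x)" for x
    using N finite_subset pair_finite_verts by blast
  have "card {y \<in> pverts G. R x y} < h\<^sup>2" if x: "x \<in> pverts G" for x
  proof -
    \<comment> \<open>A conflicting \<open>y\<close> is the end of a path x - u - y with y different
      from x. There are at most \<open>h\<close> choices of \<open>u\<close>, and then at most
      \<open>h - 1\<close> of \<open>y\<close>, since \<open>x\<close> itself is a neighbour of
      \<open>u\<close>.\<close>
    have "{y \<in> pverts G. R x y} \<subseteq> (\<Union>u\<in>?N x. ?N u - {x})"
      by (auto simp: R_def sym)
    then have "card {y \<in> pverts G. R x y} \<le> card (\<Union>u\<in>?N x. ?N u - {x})"
      using fin by (intro card_mono) auto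
    also have "\<dots> \<le> (\<Sum>u\<in>?N x. card (?N u - {x}))"
      by (rule card_UN_le[OF fin])
    also have "\<dots> \<le> (\<Sum>u\<in>?N x. h - 1)"
    proof (rule sum_mono)
      fix u assume u: "u \<in> ?N x"
      then have "x \<in> ?N u" "u \<in> pverts G"
        using sym N by blast+
      then show "card (?N u - {x}) \<le> h - 1"
        using assms by (simp add: card_Diff_singleton diff_le_mono)
    qed
    also have "\<dots> \<le> h * (h - 1)"
      using assms x by simp
    also have "\<dots> < h\<^sup>2"
      using assms by (simp add: power2_eq_square)
    finally show ?thesis .
  qed
  then obtain c where c: "c ` pverts G \<subseteq> {..<h\<^sup>2}"
    "\<forall>x\<in>pverts G. \<forall>y\<in>pverts G. x \<noteq> y \<and> R x y \<longrightarrow> c x \<noteq> c y"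
    using ex_proper_colouring[of "pverts G" R "h\<^sup>2"] pair_finite_verts
    by (metis (no_types, lifting) R_def inf_commute)
  have "disjoint_family_on ?N {v \<in> pverts G. c v = i}" for i
    unfolding disjoint_family_on_def
  proof (intro ballI impI)
    fix x y assume "x \<in> {v \<in> pverts G. c v = i}" "y \<in> {v \<in> pverts G. c v = i}" "x \<noteq> y"
    then have "\<not> R x y"
      using c(2)[rule_format, of x y] by auto
    then show "?N x \<inter> ?N y = {}"
      using \<open>x \<noteq> y\<close> by (simp add: R_def)
  qed
  then show ?thesis
    using c(1) by blast
qed

theorem lemma7:
  fixes H :: "'a pair_pre_digraph" and h l n :: nat
  assumes "h \<ge> 1" and "l \<ge> 14"
    and "pair_graph H" and "card (pverts H) = n"
    and "\<forall>v \<in> pverts H. out_degree (with_proj H) v \<le> h"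
    and "real (card {v \<in> pverts H. out_degree (with_proj H) v < l}) \<le> 1 / 60 * real n"
  shows "real (card {S. S \<subseteq> pverts H \<and> real (card (low_deg H S)) \<ge> 1 / 20 * real n})
           \<le> real h ^ 2 * 2 ^ n * exp (- (real n / (1800 * real h ^ 4)))"
proof -
  interpret pair_graph H by fact
  define V where "V = pverts H"
  define N where "N v = {u. (v, u) \<in> parcs H}" for v
  define D where "D = {v \<in> V. card (N v) < l}"
  have V: "finite V" "card V = n"
    using assms by (auto simp: V_def)
  have NV: "N v \<subseteq> V" for v
    unfolding N_def V_def using arc_snd_in_verts by force
  have deg: "out_degree (with_proj H) v = card (N v)" for v
  proof -
    have "{u \<in> pverts H. (v, u) \<in> parcs H} = N v"
      using NV by (auto simp: N_def V_def)
    then show ?thesis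
      by (simp add: out_degree_eq_deg_in deg_in_def)
  qed
  have D: "real (card D) \<le> real n / 60"
    using assms(6) by (simp add: D_def V_def deg)
  have low: "low_deg H S = {v \<in> V. card (S \<inter> N v) \<le> 2}" for S
    by (simp add: low_deg_def deg_in_def V_def N_def Collect_conj_eq)
  obtain c where c: "c ` V \<subseteq> {..<h\<^sup>2}" "\<And>i. disjoint_family_on N {v \<in> V. c v = i}"
    using ex_square_colouring[OF assms(1)] assms(5) unfolding deg V_def N_def by blast
  \<comment> \<open>The colouring \<open>c\<close> covers all of \<open>V\<close>; removing
    \<open>D\<close> leaves classes in which every neighbourhood has at least \<open>l\<close>,
    hence at least 14, elements.\<close>
  define C where "C i = {v \<in> V - D. c v = i}" for i
  \<comment> \<open>Chosen so that the excesses \<open>t\<close> of the \<open>h\<^sup>2\<close>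
    classes add up to n/60.\<close>
  define t where "t = real n / (60 * real (h\<^sup>2))"
  define F where "F i = {S. S \<subseteq> V \<and> real (card {v \<in> C i. card (S \<inter> N v) \<le> 2}) \<ge> card (C i) / 60 + t}"
    for i
  have h: "0 < h\<^sup>2"
    using assms(1) by simp
  have class_sum: "(\<Sum>i<h\<^sup>2. card {v \<in> C i. P v}) = card {v \<in> V - D. P v}" for P
  proof -
    have "{v \<in> V - D. P v} = (\<Union>i<h\<^sup>2. {v \<in> C i. P v})"
      using c(1) by (auto simp: C_def)
    then show ?thesis
      using V by (subst card_UN_disjoint[symmetric]) (auto simp: C_def)
  qed
  have F: "real (card (F i)) \<le> 2 ^ n * exp (- t)" for i
  proof -
    have "disjoint_family_on N (C i)"
      using c(2)[of i] by (rule disjoint_family_on_mono[rotated]) (auto simp: C_def)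
    moreover have "14 \<le> card (N v)" if "v \<in> C i" for v
      using that assms(2) by (auto simp: C_def D_def)
    ultimately show ?thesis
      unfolding F_def V(2)[symmetric] using V NV
      by (intro card_subsets_many_low_le) (auto simp: C_def)
  qed
  have "{S. S \<subseteq> V \<and> real (card (low_deg H S)) \<ge> 1 / 20 * real n} \<subseteq> (\<Union>i<h\<^sup>2. F i)"
  proof (rule subsetI, rule ccontr)
    fix S
    assume S: "S \<in> {S. S \<subseteq> V \<and> real (card (low_deg H S)) \<ge> 1 / 20 * real n}"
      and not: "S \<notin> (\<Union>i<h\<^sup>2. F i)"
    let ?low = "\<lambda>v. card (S \<inter> N v) \<le> 2"
    have "card (low_deg H S) \<le> card (D \<union> {v \<in> V - D. ?low v})"
      unfolding low using V by (intro card_mono) (auto simp: D_def)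
    also have "\<dots> \<le> card D + card {v \<in> V - D. ?low v}"
      by (rule card_Un_le)
    finally have "real n / 20 \<le> real (card D) + real (card {v \<in> V - D. ?low v})"
      using S by simp
    also have "real (card {v \<in> V - D. ?low v}) = (\<Sum>i<h\<^sup>2. real (card {v \<in> C i. ?low v}))"
      unfolding class_sum[symmetric] by simp
    \<comment> \<open>Strict because there is at least one colour. Together with \<open>D\<close>,
      the three contributions of n/60 then give n/20 < n/20.\<close>
    also have "\<dots> < (\<Sum>i<h\<^sup>2. real (card (C i)) / 60 + t)"
      using S not h by (intro sum_strict_mono) (auto simp: F_def not_le lessThan_empty_iff)
    also have "\<dots> = real (\<Sum>i<h\<^sup>2. card (C i)) / 60 + real n / 60"
      using h by (simp add: sum.distrib sum_divide_distrib t_def)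
    also have "\<dots> \<le> real n / 60 + real n / 60"
      using class_sum[of "\<lambda>_. True"] V card_mono[of V "{v \<in> V. v \<notin> D}"] by simp
    finally show False
      using D by simp
  qed
  then have "card {S. S \<subseteq> V \<and> real (card (low_deg H S)) \<ge> 1 / 20 * real n} \<le> card (\<Union>i<h\<^sup>2. F i)"
    using V by (intro card_mono) (auto simp: F_def)
  also have "\<dots> \<le> (\<Sum>i<h\<^sup>2. card (F i))"
    by (rule card_UN_le) simp
  finally have "real (card {S. S \<subseteq> V \<and> real (card (low_deg H S)) \<ge> 1 / 20 * real n})
      \<le> (\<Sum>i<h\<^sup>2. real (card (F i)))"
    by (simp flip: of_nat_sum)
  also have "\<dots> \<le> (\<Sum>i<h\<^sup>2. 2 ^ n * exp (- t))"
    by (intro sum_mono F)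
  also have "\<dots> = real h ^ 2 * 2 ^ n * exp (- t)"
    by simp
  also have "\<dots> \<le> real h ^ 2 * 2 ^ n * exp (- (real n / (1800 * real h ^ 4)))"
  proof -
    \<comment> \<open>The exponent reached, n / (60 h^2), is at least the one claimed, because h >=
      1.\<close>
    have "60 * real h ^ 2 \<le> 1800 * real h ^ 4"
      using assms(1) by (intro mult_mono power_increasing) auto
    then have "real n / (1800 * real h ^ 4) \<le> t"
      unfolding t_def of_nat_power using assms(1) by (intro divide_left_mono) auto
    then show ?thesis
      by (intro mult_left_mono) auto
  qed
  finally show ?thesis
    by (simp add: V_def)
qed

end
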